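(* A weakly spherically symmetric graph $(V^{\mathrm{sym}},b^{\mathrm{sym}},c^{\mathrm{sym}},m^{\mathrm{sym}})$ is stochastically complete at infinity if and only if $$\sum_{r=0}^\infty\frac{V_{q+1}(r)}{\partial B(r)}=\infty,$$ where $V_{q+1}(r)=\sum_{x\in B_r}(q^{\mathrm{sym}}(x)+1)m^{\mathrm{sym}}(x)$ and $\partial B(r)=\kappa_+^{\mathrm{sym}}(r)m^{\mathrm{sym}}(S_r)$, with balls $B_r$ and spheres $S_r$ taken around the root.
   Context: A weighted graph $(V,b,c,m)$ consists of a countably infinite set $V$, a map $m:V\to(0,\infty)$ (extended to a measure by $m(U)=\sum_{x\in U}m(x)$), a symmetric map $b:V\times V\to[0,\infty)$ with zero diagonal, and a map $c:V\to[0,\infty)$. Write $x\sim y$ if $b(x,y)>0$. All weighted graphs are assumed connected (any two vertices are joined by a finite path of successive neighbors) and locally finite (each vertex has only finitely many neighbors). Let $d$ be the combinatorial graph metric. For a fixed vertex $x_0$ and $r\in\mathbb{N}_0=\{0,1,2,\dots\}$ put $S_r=\{x:d(x,x_0)=r\}$, $S_{-1}=\emptyset$, $B_r=\bigcup_{i=0}^rS_i$. For $x\in S_r$ let $\kappa_{\pm}(x)=\frac1{m(x)}\sum_{y\in S_{r\pm1}}b(x,y)$, and let $q=c/m$. The graph is weakly spherically symmetric with root $x_0$ if $\kappa_+$, $\kappa_-$ and $q$ depend only on $d(\cdot,x_0)$; the values on $S_r$ are written $\kappa_\pm(r)$, $q(r)$. The superscript $\mathrm{sym}$ indicates the quantities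 belonging to the weakly spherically symmetric graph. The formal Laplacian is $\widetilde Lf(x)=\frac1{m(x)}\sum_{y}b(x,y)(f(x)-f(y))+\frac{c(x)}{m(x)}f(x)$ for $f:V\to\mathbb{R}$. A solution of the heat equation with initial condition $u_0$ is $u:V\times[0,\infty)\to\mathbb{R}$ such that for all $x$, $u(x,\cdot)$ is continuous on $[0,\infty)$, differentiable on $(0,\infty)$, $(\widetilde L+\frac{d}{dt})u(x,t)=0$ for $t>0$, and $u(x,0)=u_0(x)$. It is a known result that the following are equivalent: (i) there is a non-zero bounded $v:V\to[0,\infty)$ with $(\widetilde L+\alpha)v\le0$ for some (equivalently, all) $\alpha>0$; (ii) there is a bounded $v:V\to(0,\infty)$ with $(\widetilde L+\alpha)v=0$ for some (equivalently, all) $\alpha>0$; (iii) there is a non-trivial bounded solution of the heat equation with initial condition $u_0\equiv0$. The graph is called stochastically incomplete at infinity if these equivalent statements hold, and stochastically complete at infinity otherwise. *)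

theory Defs
  imports "HOL-Analysis.Analysis"
begin

text \<open>
  A graph is given by a carrier set \<open>V\<close> and functions \<open>b\<close>, \<open>c\<close>, \<open>m\<close> on the ambient type;
  their values off \<open>V\<close> are irrelevant to every definition below.
\<close>

definition neighbours :: "'a set \<Rightarrow> ('a \<Rightarrow> 'a \<Rightarrow> real) \<Rightarrow> 'a \<Rightarrow> 'a set" where
  "neighbours V b x = {y \<in> V. b x y > 0}"

definition edge_rel :: "'a set \<Rightarrow> ('a \<Rightarrow> 'a \<Rightarrow> real) \<Rightarrow> ('a \<times> 'a) set" where
  "edge_rel V b = {(x, y). x \<in> V \<and> y \<in> neighbours V b x}"

locale weighted_graph =
  fixes V :: "'a set"
    and b :: "'a \<Rightarrow> 'a \<Rightarrow> real"
    and c :: "'a \<Rightarrow> real"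
    and m :: "'a \<Rightarrow> real"
  assumes V_countable: "countable V"
    and V_infinite: "infinite V"
    and m_pos: "\<And>x. x \<in> V \<Longrightarrow> m x > 0"
    and b_nonneg: "\<And>x y. x \<in> V \<Longrightarrow> y \<in> V \<Longrightarrow> b x y \<ge> 0"
    and b_sym: "\<And>x y. x \<in> V \<Longrightarrow> y \<in> V \<Longrightarrow> b x y = b y x"
    and b_diag: "\<And>x. x \<in> V \<Longrightarrow> b x x = 0"
    and c_nonneg: "\<And>x. x \<in> V \<Longrightarrow> c x \<ge> 0"
    and connected: "\<And>x y. x \<in> V \<Longrightarrow> y \<in> V \<Longrightarrow> (x, y) \<in> (edge_rel V b)\<^sup>*"
    and locally_finite: "\<And>x. x \<in> V \<Longrightarrow> finite (neighbours V b x)"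

text \<open>The library relation power \<open>R ^^ n\<close> relates the endpoints of paths with \<open>n\<close> edges.\<close>

definition graph_dist :: "'a set \<Rightarrow> ('a \<Rightarrow> 'a \<Rightarrow> real) \<Rightarrow> 'a \<Rightarrow> 'a \<Rightarrow> nat" where
  "graph_dist V b x y = (LEAST n. (x, y) \<in> edge_rel V b ^^ n)"

text \<open>Spheres are indexed by integers, so that the sphere of radius \<open>-1\<close> is empty.\<close>

definition graph_sphere :: "'a set \<Rightarrow> ('a \<Rightarrow> 'a \<Rightarrow> real) \<Rightarrow> 'a \<Rightarrow> int \<Rightarrow> 'a set" where
  "graph_sphere V b x0 r = {x \<in> V. int (graph_dist V b x x0) = r}"

definition graph_ball :: "'a set \<Rightarrow> ('a \<Rightarrow> 'a \<Rightarrow> real) \<Rightarrow> 'a \<Rightarrow> nat \<Rightarrow> 'a set" where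
  "graph_ball V b x0 r = (\<Union>i\<in>{0..r}. graph_sphere V b x0 (int i))"

text \<open>
  By connectedness and local finiteness all spheres and balls are finite, so sums over them are
  ordinary finite sums.
\<close>

definition kappa_plus ::
  "'a set \<Rightarrow> ('a \<Rightarrow> 'a \<Rightarrow> real) \<Rightarrow> ('a \<Rightarrow> real) \<Rightarrow> 'a \<Rightarrow> 'a \<Rightarrow> real" where
  "kappa_plus V b m x0 x =
     1 / m x * (\<Sum>y\<in>graph_sphere V b x0 (int (graph_dist V b x x0) + 1). b x y)"

definition kappa_minus ::
  "'a set \<Rightarrow> ('a \<Rightarrow> 'a \<Rightarrow> real) \<Rightarrow> ('a \<Rightarrow> real) \<Rightarrow> 'a \<Rightarrow> 'a \<Rightarrow> real" where
  "kappa_minus V b m x0 x =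
     1 / m x * (\<Sum>y\<in>graph_sphere V b x0 (int (graph_dist V b x x0) - 1). b x y)"

definition potential :: "('a \<Rightarrow> real) \<Rightarrow> ('a \<Rightarrow> real) \<Rightarrow> 'a \<Rightarrow> real" where
  "potential c m x = c x / m x"

definition spherically_symmetric_fun ::
  "'a set \<Rightarrow> ('a \<Rightarrow> 'a \<Rightarrow> real) \<Rightarrow> 'a \<Rightarrow> ('a \<Rightarrow> real) \<Rightarrow> bool" where
  "spherically_symmetric_fun V b x0 f \<longleftrightarrow>
     (\<forall>x\<in>V. \<forall>y\<in>V. graph_dist V b x x0 = graph_dist V b y x0 \<longrightarrow> f x = f y)"

locale weakly_spherically_symmetric_graph = weighted_graph V b c m
  for V :: "'a set" and b c m +
  fixes x0 :: 'a
  assumes root_in_V: "x0 \<in> V"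
    and kappa_plus_sym: "spherically_symmetric_fun V b x0 (kappa_plus V b m x0)"
    and kappa_minus_sym: "spherically_symmetric_fun V b x0 (kappa_minus V b m x0)"
    and potential_sym: "spherically_symmetric_fun V b x0 (potential c m)"

text \<open>
  The common value of a spherically symmetric function on the sphere of radius \<open>r\<close>; spheres are
  non-empty because the graph is infinite, connected and locally finite.
\<close>

definition sphere_value ::
  "'a set \<Rightarrow> ('a \<Rightarrow> 'a \<Rightarrow> real) \<Rightarrow> 'a \<Rightarrow> ('a \<Rightarrow> real) \<Rightarrow> nat \<Rightarrow> real" where
  "sphere_value V b x0 f r = the_elem (f ` graph_sphere V b x0 (int r))"

definition ball_volume ::
  "'a set \<Rightarrow> ('a \<Rightarrow> 'a \<Rightarrow> real) \<Rightarrow> ('a \<Rightarrow> real) \<Rightarrow> ('a \<Rightarrow> real) \<Rightarrow> 'a \<Rightarrow> nat \<Rightarrow> real" where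
  "ball_volume V b c m x0 r = (\<Sum>x\<in>graph_ball V b x0 r. (potential c m x + 1) * m x)"

definition ball_boundary ::
  "'a set \<Rightarrow> ('a \<Rightarrow> 'a \<Rightarrow> real) \<Rightarrow> ('a \<Rightarrow> real) \<Rightarrow> 'a \<Rightarrow> nat \<Rightarrow> real" where
  "ball_boundary V b m x0 r =
     sphere_value V b x0 (kappa_plus V b m x0) r * (\<Sum>x\<in>graph_sphere V b x0 (int r). m x)"

text \<open>
  The sum over all \<open>y \<in> V\<close> in the Laplacian is written over the neighbours of \<open>x\<close>, the remaining
  terms being zero: the library's \<open>sum\<close> over an infinite set is \<open>0\<close> by convention.
\<close>

definition laplacian ::
  "'a set \<Rightarrow> ('a \<Rightarrow> 'a \<Rightarrow> real) \<Rightarrow> ('a \<Rightarrow> real) \<Rightarrow> ('a \<Rightarrow> real) \<Rightarrow> ('a \<Rightarrow> real) \<Rightarrow> 'a \<Rightarrow> real" where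
  "laplacian V b c m f x =
     1 / m x * (\<Sum>y\<in>neighbours V b x. b x y * (f x - f y)) + c x / m x * f x"

definition heat_solution ::
  "'a set \<Rightarrow> ('a \<Rightarrow> 'a \<Rightarrow> real) \<Rightarrow> ('a \<Rightarrow> real) \<Rightarrow> ('a \<Rightarrow> real) \<Rightarrow> ('a \<Rightarrow> real)
     \<Rightarrow> ('a \<Rightarrow> real \<Rightarrow> real) \<Rightarrow> bool" where
  "heat_solution V b c m u0 u \<longleftrightarrow>
     (\<forall>x\<in>V. continuous_on {0..} (u x) \<and> u x differentiable_on {0<..} \<and>
        (\<forall>t>0. laplacian V b c m (\<lambda>y. u y t) x + deriv (u x) t = 0) \<and>
        u x 0 = u0 x)"

definition has_bounded_subsolution ::
  "'a set \<Rightarrow> ('a \<Rightarrow> 'a \<Rightarrow> real) \<Rightarrow> ('a \<Rightarrow> real) \<Rightarrow> ('a \<Rightarrow> real) \<Rightarrow> real \<Rightarrow> bool" where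
  "has_bounded_subsolution V b c m \<alpha> \<longleftrightarrow>
     (\<exists>v. (\<forall>x\<in>V. v x \<ge> 0) \<and> bounded (v ` V) \<and> (\<exists>x\<in>V. v x \<noteq> 0) \<and>
        (\<forall>x\<in>V. laplacian V b c m v x + \<alpha> * v x \<le> 0))"

definition has_bounded_positive_solution ::
  "'a set \<Rightarrow> ('a \<Rightarrow> 'a \<Rightarrow> real) \<Rightarrow> ('a \<Rightarrow> real) \<Rightarrow> ('a \<Rightarrow> real) \<Rightarrow> real \<Rightarrow> bool" where
  "has_bounded_positive_solution V b c m \<alpha> \<longleftrightarrow>
     (\<exists>v. (\<forall>x\<in>V. v x > 0) \<and> bounded (v ` V) \<and>
        (\<forall>x\<in>V. laplacian V b c m v x + \<alpha> * v x = 0))"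

definition has_nontrivial_bounded_heat_solution ::
  "'a set \<Rightarrow> ('a \<Rightarrow> 'a \<Rightarrow> real) \<Rightarrow> ('a \<Rightarrow> real) \<Rightarrow> ('a \<Rightarrow> real) \<Rightarrow> bool" where
  "has_nontrivial_bounded_heat_solution V b c m \<longleftrightarrow>
     (\<exists>u. heat_solution V b c m (\<lambda>x. 0) u \<and>
        bounded {u x t | x t. x \<in> V \<and> t \<ge> 0} \<and>
        (\<exists>x\<in>V. \<exists>t\<ge>0. u x t \<noteq> 0))"

text \<open>
  For weighted graphs the three disjuncts below are known to be equivalent to each other (and to
  the versions quantified over all \<open>\<alpha> > 0\<close>). The graph is incomplete when one of them holds, so it
  is complete when all of them fail.
\<close>

definition stochastically_incomplete_at_infinity ::
  "'a set \<Rightarrow> ('a \<Rightarrow> 'a \<Rightarrow> real) \<Rightarrow> ('a \<Rightarrow> real) \<Rightarrow> ('a \<Rightarrow> real) \<Rightarrow> bool" where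
  "stochastically_incomplete_at_infinity V b c m \<longleftrightarrow>
     (\<exists>\<alpha>>0. has_bounded_subsolution V b c m \<alpha>) \<or>
     (\<exists>\<alpha>>0. has_bounded_positive_solution V b c m \<alpha>) \<or>
     has_nontrivial_bounded_heat_solution V b c m"

definition stochastically_complete_at_infinity ::
  "'a set \<Rightarrow> ('a \<Rightarrow> 'a \<Rightarrow> real) \<Rightarrow> ('a \<Rightarrow> real) \<Rightarrow> ('a \<Rightarrow> real) \<Rightarrow> bool" where
  "stochastically_complete_at_infinity V b c m \<longleftrightarrow>
     \<not> stochastically_incomplete_at_infinity V b c m"

end

theory Submission
  imports Defs
begin

text \<open>
  Among the functions of the distance \<open>r\<close> to the root, the equation \<open>(L + \<alpha>) w = 0\<close>, with \<open>L\<close>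
  the formal Laplacian, is a recursion, because on such functions \<open>L\<close> involves only \<open>\<kappa>\<^sub>+\<close>,
  \<open>\<kappa>\<^sub>-\<close> and \<open>q\<close>. Multiplied by \<open>m(S\<^sub>r)\<close> and summed over \<open>r\<close>, it becomes a flux identity:
  since \<open>\<kappa>\<^sub>-(r + 1) m(S\<^sub>r\<^sub>+\<^sub>1) = \<kappa>\<^sub>+(r) m(S\<^sub>r) = \<partial>B(r)\<close> (both count the edge weight between
  the two spheres, \<open>edge_weight_balance\<close>), the sum telescopes to
  \<open>\<partial>B(r) (w(r + 1) - w(r)) = \<Sum>i\<le>r. (q(i) + \<alpha>) m(S\<^sub>i) w(i)\<close>.
  So the solution with \<open>w(0) = 1\<close> exists, is at least 1 and increases, and bounding the \<open>w(i)\<close>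
  on the right below by 1 and above by \<open>w(r)\<close> gives, with
  \<open>a(r) = (\<Sum>i\<le>r. (q(i) + \<alpha>) m(S\<^sub>i)) / \<partial>B(r)\<close>,
  \<open>\<Sum>k<r. a(k) \<le> w(r) \<le> exp (\<Sum>k<r. a(k))\<close>.
  Hence \<open>w\<close> is bounded if and only if the series of the \<open>a(r)\<close> converges; for \<open>\<alpha> = 1\<close> this is the
  series of the theorem.

  If that series converges, \<open>w\<close> for \<open>\<alpha> = 1\<close> is a bounded positive solution and the
  graph is incomplete. If it diverges, so does the series for every \<open>\<alpha> > 0\<close>
  (\<open>not_summable_shell_weights\<close>), and every \<open>w\<close> tends to infinity along the finite spheres.
  It then serves as a barrier of Khasminskii type: for a bounded function \<open>v\<close> and \<open>\<epsilon> > 0\<close>, the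
  difference \<open>v - \<epsilon> w\<close> is positive on a finite set at most, so it attains a maximum there if it is
  positive anywhere, and the maximum principle rules this out when \<open>(L + \<alpha>) v \<le> 0\<close>
  (\<open>no_bounded_subsolution\<close>). The same comparison with the time-dependent barrier
  \<open>exp ((\<alpha> + 1) t) w\<close> shows directly that a bounded solution of the heat equation with
  initial value zero vanishes (\<open>no_nontrivial_bounded_heat_solution\<close>). All three disjuncts in the
  definition of incompleteness therefore fail.
\<close>

section \<open>The maximum principle and proper supersolutions\<close>

context weighted_graph
begin

lemma laplacian_nonneg_at_max:
  assumes "x \<in> V" "f x \<ge> 0" "\<And>y. y \<in> V \<Longrightarrow> f y \<le> f x"
  shows "laplacian V b c m f x \<ge> 0"
proof -
  have "(\<Sum>y\<in>neighbours V b x. b x y * (f x - f y)) \<ge> 0"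
    using assms by (intro sum_nonneg mult_nonneg_nonneg) (auto simp: neighbours_def)
  then show ?thesis
    using assms m_pos[of x] c_nonneg[of x] by (simp add: laplacian_def)
qed

lemma laplacian_diff_scaled:
  "laplacian V b c m (\<lambda>y. f y - k * g y) x = laplacian V b c m f x - k * laplacian V b c m g x"
proof -
  have "(\<Sum>y\<in>neighbours V b x. b x y * ((f x - k * g x) - (f y - k * g y))) =
      (\<Sum>y\<in>neighbours V b x. b x y * (f x - f y)) -
      k * (\<Sum>y\<in>neighbours V b x. b x y * (g x - g y))"
    by (simp add: sum_distrib_left sum_subtractf[symmetric] algebra_simps)
  then show ?thesis
    unfolding laplacian_def by (simp only: right_diff_distrib distrib_left) (simp add: algebra_simps)
qed

text \<open>
  Subtracting a small multiple of the proper function \<open>w\<close> from a bounded subsolution forces a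
  positive maximum. There the Laplacian of the difference is non-negative and \<open>\<alpha>\<close> times the
  difference is positive, although the difference is again a subsolution.
\<close>

lemma no_bounded_subsolution:
  assumes "\<alpha> > 0"
    and pos: "\<And>x. x \<in> V \<Longrightarrow> w x > 0"
    and proper: "\<And>K. finite {x \<in> V. w x \<le> K}"
    and super: "\<And>x. x \<in> V \<Longrightarrow> laplacian V b c m w x + \<alpha> * w x \<ge> 0"
  shows "\<not> has_bounded_subsolution V b c m \<alpha>"
proof
  assume "has_bounded_subsolution V b c m \<alpha>"
  then obtain v z where v: "\<And>x. x \<in> V \<Longrightarrow> v x \<ge> 0" "bounded (v ` V)" "z \<in> V" "v z \<noteq> 0"
    "\<And>x. x \<in> V \<Longrightarrow> laplacian V b c m v x + \<alpha> * v x \<le> 0"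
    unfolding has_bounded_subsolution_def by blast
  obtain K where K: "\<And>x. x \<in> V \<Longrightarrow> \<bar>v x\<bar> \<le> K"
    using v(2) unfolding bounded_iff by auto
  have vz: "v z > 0" using v(1)[OF v(3)] v(4) by simp
  \<comment> \<open>Small enough that \<open>v - \<epsilon> w\<close> is still positive at \<open>z\<close>.\<close>
  define \<epsilon> where "\<epsilon> = v z / (2 * w z)"
  have eps: "\<epsilon> > 0" using vz pos[OF v(3)] by (simp add: \<epsilon>_def)
  define g where "g = (\<lambda>x. v x - \<epsilon> * w x)"
  define F where "F = {x \<in> V. w x \<le> K / \<epsilon>}"
  have gz: "g z > 0" using vz pos[OF v(3)] by (simp add: g_def \<epsilon>_def)
  have in_F: "x \<in> F" if "x \<in> V" "g x > 0" for x
  proof -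
    have "\<epsilon> * w x \<le> K" using that K[OF that(1)] by (simp add: g_def)
    then show ?thesis using eps that by (simp add: F_def field_simps)
  qed
  have F: "finite F" "z \<in> F" using proper[of "K / \<epsilon>"] in_F[OF v(3) gz] by (auto simp: F_def)
  obtain x where x: "x \<in> F" "\<And>y. y \<in> F \<Longrightarrow> g y \<le> g x"
    using ex_is_arg_min_if_finite[of F "\<lambda>y. - g y"] F by (auto simp: is_arg_min_linorder)
  have xV: "x \<in> V" using x by (simp add: F_def)
  have gx: "g x > 0" using x(2)[OF F(2)] gz by simp
  have "g y \<le> g x" if "y \<in> V" for y
    using in_F[OF that] x(2)[of y] gx by (cases "g y > 0") auto
  then have "laplacian V b c m g x \<ge> 0"
    using xV gx by (intro laplacian_nonneg_at_max) auto
  moreover have "laplacian V b c m g x + \<alpha> * g x \<le> 0"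
  proof -
    have "\<epsilon> * (laplacian V b c m w x + \<alpha> * w x) \<ge> 0" using eps super[OF xV] by simp
    with v(5)[OF xV] show ?thesis
      by (simp add: g_def laplacian_diff_scaled algebra_simps)
  qed
  moreover have "\<alpha> * g x > 0" using gx assms(1) by simp
  ultimately show False by linarith
qed

text \<open>
  The parabolic counterpart: \<open>u - \<epsilon> exp (\<beta> t) w\<close> is negative at time 0 and non-positive off a finite
  set of vertices, so if it is positive somewhere it attains a positive maximum over
  \<open>[0, t1]\<close> at a time \<open>T > 0\<close>. There the spatial Laplacian and the time derivative are both
  non-negative, the latter because the values before \<open>T\<close> are no larger.
\<close>

lemma bounded_heat_solution_le_0:
  assumes pos: "\<And>x. x \<in> V \<Longrightarrow> w x > 0"
    and proper: "\<And>K. finite {x \<in> V. w x \<le> K}"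
    and super: "\<And>x. x \<in> V \<Longrightarrow> laplacian V b c m w x + \<alpha> * w x \<ge> 0"
    and "\<alpha> > 0"
    and u: "heat_solution V b c m (\<lambda>x. 0) u"
    and K: "\<And>x t. x \<in> V \<Longrightarrow> t \<ge> 0 \<Longrightarrow> u x t \<le> K"
    and z: "z \<in> V" "t1 \<ge> 0"
  shows "u z t1 \<le> 0"
proof (rule ccontr)
  assume "\<not> u z t1 \<le> 0"
  then have uz: "u z t1 > 0" by simp
  \<comment> \<open>Already \<open>exp (\<alpha> t) w\<close> is a supersolution of the heat equation; the larger rate makes it a strict
      one, which is what contradicts two merely non-negative terms.\<close>
  define \<beta> where "\<beta> = \<alpha> + 1"
  define \<epsilon> where "\<epsilon> = u z t1 / (2 * exp (\<beta> * t1) * w z)"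
  have eps: "\<epsilon> > 0" using uz pos[OF z(1)] by (simp add: \<epsilon>_def)
  define g where "g = (\<lambda>x t. u x t - \<epsilon> * exp (\<beta> * t) * w x)"
  define F where "F = {x \<in> V. w x \<le> K / \<epsilon>}"
  have gz: "g z t1 > 0" using uz pos[OF z(1)] by (simp add: g_def \<epsilon>_def)
  have in_F: "x \<in> F" if "x \<in> V" "t \<ge> 0" "g x t > 0" for x t
  proof -
    have "\<epsilon> * w x * 1 \<le> \<epsilon> * w x * exp (\<beta> * t)"
      using eps pos[OF that(1)] that(2) \<open>\<alpha> > 0\<close> by (intro mult_left_mono) (auto simp: \<beta>_def)
    then have "\<epsilon> * w x \<le> K" using that K[OF that(1,2)] by (simp add: g_def mult_ac)
    then show ?thesis using eps that by (simp add: F_def field_simps)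
  qed
  have F: "finite F" "z \<in> F" using proper[of "K / \<epsilon>"] in_F[OF z gz] by (auto simp: F_def)
  have FV: "x \<in> V" if "x \<in> F" for x using that by (simp add: F_def)
  have cont: "continuous_on {0..t1} (g x)" if "x \<in> V" for x
  proof -
    have "continuous_on {0..} (u x)" using u that by (simp add: heat_solution_def)
    then have "continuous_on {0..t1} (u x)" by (rule continuous_on_subset) auto
    then show ?thesis unfolding g_def by (intro continuous_intros)
  qed
  have "\<exists>s. s \<in> {0..t1} \<and> (\<forall>t\<in>{0..t1}. g x t \<le> g x s)" if "x \<in> V" for x
    using continuous_attains_sup[OF _ _ cont[OF that]] z(2) by auto
  then obtain s where s: "\<And>x. x \<in> V \<Longrightarrow> s x \<in> {0..t1}"
    "\<And>x t. x \<in> V \<Longrightarrow> t \<in> {0..t1} \<Longrightarrow> g x t \<le> g x (s x)"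
    by metis
  obtain x where x: "x \<in> F" "\<And>y. y \<in> F \<Longrightarrow> g y (s y) \<le> g x (s x)"
    using ex_is_arg_min_if_finite[of F "\<lambda>y. - g y (s y)"] F by (auto simp: is_arg_min_linorder)
  define T where "T = s x"
  have xV: "x \<in> V" using x FV by simp
  have gx: "g x T > 0"
    using x(2)[OF F(2)] s(2)[of z t1] z gz by (auto simp: T_def)
  have T: "T \<ge> 0" "T \<le> t1" using s(1)[OF xV] by (auto simp: T_def)
  have "T \<noteq> 0"
  proof
    assume "T = 0"
    have "u x 0 = 0" using u xV by (simp add: heat_solution_def)
    then have "g x 0 < 0" using eps pos[OF xV] by (simp add: g_def)
    with gx \<open>T = 0\<close> show False by simp
  qed
  then have T0: "T > 0" using T by simp
  \<comment> \<open>\<open>x\<close> maximises over \<open>F\<close> only; a vertex outside \<open>F\<close> has a non-positive value at time \<open>T\<close>.\<close>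
  have "g y T \<le> g x T" if "y \<in> V" for y
  proof (cases "g y T > 0")
    case True
    then show ?thesis
      using in_F[OF that T(1)] x(2)[of y] s(2)[OF that, of T] T by (force simp: T_def)
  qed (use gx in auto)
  then have Lg: "laplacian V b c m (\<lambda>y. g y T) x \<ge> 0"
    using xV gx by (intro laplacian_nonneg_at_max) auto
  have udiff: "u x differentiable_on {0<..}" using u xV by (simp add: heat_solution_def)
  then have "u x differentiable (at T within {0<..})"
    using T0 by (auto simp: differentiable_on_def)
  then have "u x differentiable (at T)" using T0 by (simp add: at_within_open[of T "{0<..}"])
  then have du: "(u x has_real_derivative deriv (u x) T) (at T)"
    by (simp add: DERIV_deriv_iff_real_differentiable)
  define g' where "g' = deriv (u x) T - \<epsilon> * (\<beta> * exp (\<beta> * T)) * w x"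
  have dg: "(g x has_real_derivative g') (at T)"
    unfolding g_def g'_def
    by (rule derivative_eq_intros du refl | simp add: mult_ac)+
  have g': "g' \<ge> 0"
  proof (rule ccontr)
    assume "\<not> g' \<ge> 0"
    then obtain d where d: "d > 0" "\<And>h. h > 0 \<Longrightarrow> h < d \<Longrightarrow> g x T < g x (T - h)"
      using DERIV_neg_dec_left[OF dg] by auto
    \<comment> \<open>The cap at \<open>T\<close> keeps \<open>T - h\<close> inside the time interval.\<close>
    define h where "h = min (d / 2) T"
    have "g x T < g x (T - h)" using d T0 by (intro d) (auto simp: h_def min_def)
    moreover have "g x (T - h) \<le> g x T"
      using s(2)[OF xV, of "T - h"] T T0 d(1) by (auto simp: h_def T_def)
    ultimately show False by simp
  qed
  let ?k = "\<epsilon> * exp (\<beta> * T)"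
  have "laplacian V b c m (\<lambda>y. u y T) x + deriv (u x) T = 0"
    using u xV T0 by (simp add: heat_solution_def)
  moreover have "laplacian V b c m (\<lambda>y. g y T) x =
      laplacian V b c m (\<lambda>y. u y T) x - ?k * laplacian V b c m w x"
    unfolding g_def by (rule laplacian_diff_scaled)
  ultimately have "laplacian V b c m (\<lambda>y. g y T) x + g' =
      - ?k * (laplacian V b c m w x + \<alpha> * w x) - ?k * w x"
    by (simp add: g'_def \<beta>_def algebra_simps)
  moreover have "?k * (laplacian V b c m w x + \<alpha> * w x) \<ge> 0" "?k * w x > 0"
    using eps super[OF xV] pos[OF xV] by auto
  ultimately show False using Lg g' by simp
qed

lemma heat_solution_uminus:
  assumes "heat_solution V b c m (\<lambda>x. 0) u"
  shows "heat_solution V b c m (\<lambda>x. 0) (\<lambda>x t. - u x t)"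
  unfolding heat_solution_def
proof (intro ballI conjI allI impI)
  fix x assume x: "x \<in> V"
  show "continuous_on {0..} (\<lambda>t. - u x t)" "(\<lambda>t. - u x t) differentiable_on {0<..}" "- u x 0 = 0"
    using assms x by (auto simp: heat_solution_def intro!: continuous_intros derivative_intros)
  fix t :: real assume t: "t > 0"
  have "u x differentiable (at t within {0<..})"
    using t assms x by (auto simp: heat_solution_def differentiable_on_def)
  then have "u x differentiable (at t)" using t by (simp add: at_within_open[of t "{0<..}"])
  then have "deriv (\<lambda>t. - u x t) t = - deriv (u x) t"
    by (intro DERIV_imp_deriv DERIV_minus) (simp add: DERIV_deriv_iff_real_differentiable)
  moreover have "laplacian V b c m (\<lambda>y. - u y t) x = - laplacian V b c m (\<lambda>y. u y t) x"
    using laplacian_diff_scaled[of "\<lambda>_. 0" 1 "\<lambda>y. u y t" x] by (simp add: laplacian_def)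
  moreover have "laplacian V b c m (\<lambda>y. u y t) x + deriv (u x) t = 0"
    using assms x t by (simp add: heat_solution_def)
  ultimately show "laplacian V b c m (\<lambda>y. - u y t) x + deriv (\<lambda>t. - u x t) t = 0"
    by simp
qed

lemma no_nontrivial_bounded_heat_solution:
  assumes "\<And>x. x \<in> V \<Longrightarrow> w x > 0"
    and "\<And>K. finite {x \<in> V. w x \<le> K}"
    and "\<And>x. x \<in> V \<Longrightarrow> laplacian V b c m w x + \<alpha> * w x \<ge> 0"
    and "\<alpha> > 0"
  shows "\<not> has_nontrivial_bounded_heat_solution V b c m"
proof
  assume "has_nontrivial_bounded_heat_solution V b c m"
  then obtain u z t where u: "heat_solution V b c m (\<lambda>x. 0) u"
    "bounded {u x t | x t. x \<in> V \<and> t \<ge> 0}" "z \<in> V" "t \<ge> 0" "u z t \<noteq> 0"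
    unfolding has_nontrivial_bounded_heat_solution_def by blast
  obtain K where K: "\<And>x t. x \<in> V \<Longrightarrow> t \<ge> 0 \<Longrightarrow> \<bar>u x t\<bar> \<le> K"
    using u(2) unfolding bounded_iff by force
  have "u x t \<le> K" "- u x t \<le> K" if "x \<in> V" "t \<ge> 0" for x t
    using K[OF that] by auto
  then have "u z t \<le> 0" "- u z t \<le> 0"
    using bounded_heat_solution_le_0[OF assms u(1) _ u(3,4)]
      bounded_heat_solution_le_0[OF assms heat_solution_uminus[OF u(1)] _ u(3,4)] by blast+
  with u(5) show False by simp
qed

end

section \<open>The radial recursion\<close>

text \<open>
  The flux identity solved for the next value. Here \<open>M r\<close> stands for \<open>(q(r) + \<alpha>) m(S\<^sub>r)\<close> and \<open>D r\<close>
  for \<open>\<partial>B(r)\<close>.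
\<close>

fun radial_solution :: "(nat \<Rightarrow> real) \<Rightarrow> (nat \<Rightarrow> real) \<Rightarrow> nat \<Rightarrow> real" where
  "radial_solution M D 0 = 1"
| "radial_solution M D (Suc r) =
     radial_solution M D r + (\<Sum>i\<le>r. M i * radial_solution M D i) / D r"

context
  fixes M D :: "nat \<Rightarrow> real"
  assumes M: "\<And>r. M r \<ge> 0" and D: "\<And>r. D r > 0"
begin

lemma radial_solution_ge_1: "radial_solution M D r \<ge> 1"
proof (induction r rule: less_induct)
  case (less r)
  show ?case
  proof (cases r)
    case (Suc k)
    have "M i * radial_solution M D i \<ge> 0" if "i \<le> k" for i
      using M[of i] less[of i] that Suc by (intro mult_nonneg_nonneg) auto
    then have "(\<Sum>i\<le>k. M i * radial_solution M D i) / D k \<ge> 0"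
      using D[of k] by (intro divide_nonneg_pos sum_nonneg) auto
    then show ?thesis using less[of k] Suc by simp
  qed simp
qed

lemma incseq_radial_solution: "incseq (radial_solution M D)"
proof (rule incseq_SucI)
  fix r
  have "M i * radial_solution M D i \<ge> 0" for i
    using M[of i] radial_solution_ge_1[of i] by (intro mult_nonneg_nonneg) auto
  then show "radial_solution M D r \<le> radial_solution M D (Suc r)"
    using D[of r] by (simp add: sum_nonneg less_imp_le)
qed

text \<open>
  Bounding the earlier values below by 1 turns every increment into at least a term of the series.
\<close>

lemma radial_solution_ge_sum: "radial_solution M D r \<ge> (\<Sum>k<r. (\<Sum>i\<le>k. M i) / D k)"
proof (induction r)
  case (Suc r)
  have "(\<Sum>i\<le>r. M i * 1) \<le> (\<Sum>i\<le>r. M i * radial_solution M D i)"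
    using M radial_solution_ge_1 by (intro sum_mono mult_left_mono) auto
  then have "(\<Sum>i\<le>r. M i) / D r \<le> (\<Sum>i\<le>r. M i * radial_solution M D i) / D r"
    using D[of r] by (intro divide_right_mono) auto
  with Suc show ?case by simp
qed simp

text \<open>
  By monotonicity the earlier values are at most \<open>w(r)\<close>, so \<open>w(r + 1) \<le> (1 + a(r)) w(r)\<close>: a discrete
  Gronwall estimate.
\<close>

lemma radial_solution_le_exp_sum:
  "radial_solution M D r \<le> exp (\<Sum>k<r. (\<Sum>i\<le>k. M i) / D k)"
proof (induction r)
  case (Suc r)
  let ?w = "radial_solution M D" and ?a = "(\<Sum>i\<le>r. M i) / D r"
  have "(\<Sum>i\<le>r. M i * ?w i) \<le> (\<Sum>i\<le>r. M i * ?w r)"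
    using M incseqD[OF incseq_radial_solution] by (intro sum_mono mult_left_mono) auto
  then have "(\<Sum>i\<le>r. M i * ?w i) / D r \<le> ?a * ?w r"
    using D[of r] by (simp add: sum_distrib_right divide_right_mono)
  then have "?w (Suc r) \<le> ?w r * (1 + ?a)" by (simp add: algebra_simps)
  also have "\<dots> \<le> exp (\<Sum>k<r. (\<Sum>i\<le>k. M i) / D k) * exp ?a"
    using Suc radial_solution_ge_1[of r] M D[of r]
    by (intro mult_mono exp_ge_add_one_self) (auto intro!: add_nonneg_nonneg divide_nonneg_pos sum_nonneg)
  finally show ?case by (simp add: exp_add)
qed simp

lemma bounded_radial_solution:
  assumes "summable (\<lambda>r. (\<Sum>i\<le>r. M i) / D r)"
  shows "\<exists>K. \<forall>r. radial_solution M D r \<le> K"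
proof (intro exI allI)
  fix r
  have "(\<Sum>k<r. (\<Sum>i\<le>k. M i) / D k) \<le> (\<Sum>k. (\<Sum>i\<le>k. M i) / D k)"
    using M D by (intro sum_le_suminf assms) (auto intro!: divide_nonneg_pos sum_nonneg)
  then show "radial_solution M D r \<le> exp (\<Sum>k. (\<Sum>i\<le>k. M i) / D k)"
    using radial_solution_le_exp_sum[of r] by (meson exp_le_cancel_iff order_trans)
qed

lemma finite_radial_solution_sublevel:
  assumes "\<not> summable (\<lambda>r. (\<Sum>i\<le>r. M i) / D r)"
  shows "finite {r. radial_solution M D r \<le> K}"
proof -
  have "\<exists>r. (\<Sum>k<r. (\<Sum>i\<le>k. M i) / D k) > K"
  proof (rule ccontr)
    assume "\<nexists>r. (\<Sum>k<r. (\<Sum>i\<le>k. M i) / D k) > K"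
    then have "(\<Sum>k<r. norm ((\<Sum>i\<le>k. M i) / D k)) \<le> K" for r
      using M D by (simp add: not_less sum_nonneg less_imp_le)
    then have "summable (\<lambda>r. (\<Sum>i\<le>r. M i) / D r)"
      by (intro summable_norm_cancel[OF bounded_imp_summable[of _ K]])
        (auto simp: lessThan_Suc_atMost[symmetric] simp del: sum.lessThan_Suc)
    with assms show False by simp
  qed
  then obtain R where R: "(\<Sum>k<R. (\<Sum>i\<le>k. M i) / D k) > K" by blast
  have "{r. radial_solution M D r \<le> K} \<subseteq> {..<R}"
  proof
    fix r assume "r \<in> {r. radial_solution M D r \<le> K}"
    then have "radial_solution M D r < radial_solution M D R"
      using R radial_solution_ge_sum[of R] by simp
    then show "r \<in> {..<R}" using incseqD[OF incseq_radial_solution, of R r] by force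
  qed
  then show ?thesis by (rule finite_subset) simp
qed

end

section \<open>Spheres around the root\<close>

context weakly_spherically_symmetric_graph
begin

abbreviation depth :: "'a \<Rightarrow> nat" where
  "depth x \<equiv> graph_dist V b x x0"

text \<open>
  A separate constant for natural radii: in \<open>graph_sphere\<close> the integer index \<open>int (Suc r)\<close> would be
  rewritten to \<open>1 + int r\<close>, after which rules about \<open>shell (Suc r)\<close> no longer match.
\<close>

definition shell :: "nat \<Rightarrow> 'a set" where
  "shell r = graph_sphere V b x0 (int r)"

lemma in_shell_iff: "x \<in> shell r \<longleftrightarrow> x \<in> V \<and> depth x = r"
  by (auto simp: shell_def graph_sphere_def)

lemma path_to_root: "x \<in> V \<Longrightarrow> (x, x0) \<in> edge_rel V b ^^ depth x"
  using connected[OF _ root_in_V, of x] unfolding graph_dist_def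
  by (metis LeastI rtrancl_power)

lemma depth_le: "(x, x0) \<in> edge_rel V b ^^ n \<Longrightarrow> depth x \<le> n"
  unfolding graph_dist_def by (rule Least_le)

lemma depth_le_Suc_neighbour:
  assumes "x \<in> V" "y \<in> V" "b x y > 0"
  shows "depth x \<le> Suc (depth y)"
proof (rule depth_le)
  have "(x, y) \<in> edge_rel V b" using assms by (simp add: edge_rel_def neighbours_def)
  then show "(x, x0) \<in> edge_rel V b ^^ Suc (depth y)"
    using path_to_root[OF assms(2)] by (rule relpow_Suc_I2)
qed

lemma obtain_inner_neighbour:
  assumes "x \<in> shell (Suc r)"
  obtains y where "y \<in> shell r" "b x y > 0"
proof -
  have x: "x \<in> V" "depth x = Suc r" using assms by (auto simp: in_shell_iff)
  then have "(x, x0) \<in> edge_rel V b ^^ Suc r" using path_to_root by metis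
  then obtain y where y: "(x, y) \<in> edge_rel V b" "(y, x0) \<in> edge_rel V b ^^ r"
    by (rule relpow_Suc_E2)
  then have yV: "y \<in> V" "b x y > 0" by (auto simp: edge_rel_def neighbours_def)
  have "depth y = r"
    using depth_le[OF y(2)] depth_le_Suc_neighbour[OF x(1) yV] x(2) by simp
  with yV show ?thesis by (intro that) (auto simp: in_shell_iff)
qed

lemma shell_0: "shell 0 = {x0}"
proof -
  have "depth x0 = 0" using depth_le[of x0 0] by simp
  moreover have "x = x0" if "x \<in> V" "depth x = 0" for x
    using path_to_root[OF that(1)] that(2) by simp
  ultimately show ?thesis using root_in_V by (auto simp: in_shell_iff)
qed

lemma finite_shell: "finite (shell r)"
proof (induction r)
  case 0
  show ?case using shell_0 by simp
next
  case (Suc r)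
  have "shell (Suc r) \<subseteq> (\<Union>y\<in>shell r. neighbours V b y)"
  proof
    fix x assume x: "x \<in> shell (Suc r)"
    then obtain y where "y \<in> shell r" "b x y > 0" by (rule obtain_inner_neighbour)
    then show "x \<in> (\<Union>y\<in>shell r. neighbours V b y)"
      using x b_sym[of x y] by (auto simp: in_shell_iff neighbours_def)
  qed
  moreover have "finite (\<Union>y\<in>shell r. neighbours V b y)"
    using Suc locally_finite by (auto simp: in_shell_iff)
  ultimately show ?case by (rule finite_subset)
qed

text \<open>
  An empty sphere makes all later ones empty, since a path to the root passes through every
  smaller distance; the whole graph would then be a finite union of finite spheres.
\<close>

lemma shell_nonempty: "shell r \<noteq> {}"
proof
  assume empty: "shell r = {}"
  have step: "shell (r + k) = {}" for k
  proof (induction k)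
    case (Suc k)
    then show ?case by (auto elim: obtain_inner_neighbour)
  qed (use empty in simp)
  have "x \<in> (\<Union>i<r. shell i)" if "x \<in> V" for x
  proof -
    have "x \<in> shell (depth x)" using that by (simp add: in_shell_iff)
    then have "depth x < r" using step[of "depth x - r"] by (cases "depth x < r") auto
    with \<open>x \<in> shell (depth x)\<close> show ?thesis by blast
  qed
  then have "V \<subseteq> (\<Union>i<r. shell i)" by blast
  then have "finite V" by (rule finite_subset) (simp add: finite_shell)
  with V_infinite show False by simp
qed

lemma sphere_value_eq:
  assumes "spherically_symmetric_fun V b x0 f" "x \<in> shell r"
  shows "sphere_value V b x0 f r = f x"
proof -
  have "f y = f x" if "y \<in> shell r" for y
    using assms that unfolding spherically_symmetric_fun_def in_shell_iff by metis
  then have "f ` shell r = {f x}" using assms(2) by blast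
  then show ?thesis by (simp add: sphere_value_def shell_def)
qed

definition shell_mass :: "nat \<Rightarrow> real" where
  "shell_mass r = (\<Sum>x\<in>shell r. m x)"

abbreviation out_degree :: "nat \<Rightarrow> real" where
  "out_degree \<equiv> sphere_value V b x0 (kappa_plus V b m x0)"

abbreviation in_degree :: "nat \<Rightarrow> real" where
  "in_degree \<equiv> sphere_value V b x0 (kappa_minus V b m x0)"

abbreviation radial_potential :: "nat \<Rightarrow> real" where
  "radial_potential \<equiv> sphere_value V b x0 (potential c m)"

lemma shell_mass_pos: "shell_mass r > 0"
  unfolding shell_mass_def using finite_shell shell_nonempty
  by (intro sum_pos m_pos) (auto simp: in_shell_iff)

lemma radial_potential_nonneg: "radial_potential r \<ge> 0"
proof -
  obtain x where x: "x \<in> shell r" using shell_nonempty by blast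
  then have "potential c m x \<ge> 0"
    using c_nonneg[of x] m_pos[of x] by (simp add: potential_def in_shell_iff)
  then show ?thesis using sphere_value_eq[OF potential_sym x] by simp
qed

lemma ball_boundary_eq: "ball_boundary V b m x0 r = out_degree r * shell_mass r"
  by (simp add: ball_boundary_def shell_mass_def shell_def)

lemma out_degree_times_mass:
  assumes "x \<in> shell r"
  shows "out_degree r * m x = (\<Sum>y\<in>shell (Suc r). b x y)"
proof -
  have x: "x \<in> V" "depth x = r" using assms by (simp_all add: in_shell_iff)
  have outer: "graph_sphere V b x0 (int r + 1) = shell (Suc r)"
    by (simp add: shell_def add.commute)
  show ?thesis
    unfolding sphere_value_eq[OF kappa_plus_sym assms] kappa_plus_def x(2) outer
    using m_pos[OF x(1)] by simp
qed

lemma in_degree_times_mass: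
  assumes "x \<in> shell (Suc r)"
  shows "in_degree (Suc r) * m x = (\<Sum>y\<in>shell r. b x y)"
proof -
  have x: "x \<in> V" "depth x = Suc r" using assms by (simp_all add: in_shell_iff)
  have inner: "graph_sphere V b x0 (int (Suc r) - 1) = shell r"
    by (simp add: shell_def)
  show ?thesis
    unfolding sphere_value_eq[OF kappa_minus_sym assms] kappa_minus_def x(2) inner
    using m_pos[OF x(1)] by simp
qed

lemma out_degree_times_shell_mass:
  "out_degree r * shell_mass r = (\<Sum>x\<in>shell r. \<Sum>y\<in>shell (Suc r). b x y)"
  by (simp add: shell_mass_def sum_distrib_left out_degree_times_mass)

lemma in_degree_times_shell_mass:
  "in_degree (Suc r) * shell_mass (Suc r) = (\<Sum>x\<in>shell (Suc r). \<Sum>y\<in>shell r. b x y)"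
  by (simp add: shell_mass_def sum_distrib_left in_degree_times_mass)

text \<open>
  Both sides are the total weight of the edges between two successive spheres.
\<close>

lemma edge_weight_balance:
  "in_degree (Suc r) * shell_mass (Suc r) = out_degree r * shell_mass r"
proof -
  have "(\<Sum>x\<in>shell (Suc r). \<Sum>y\<in>shell r. b x y) = (\<Sum>x\<in>shell (Suc r). \<Sum>y\<in>shell r. b y x)"
    by (intro sum.cong refl) (simp add: b_sym in_shell_iff)
  also have "\<dots> = (\<Sum>y\<in>shell r. \<Sum>x\<in>shell (Suc r). b y x)" by (rule sum.swap)
  finally show ?thesis
    by (simp only: out_degree_times_shell_mass in_degree_times_shell_mass)
qed

lemma in_degree_0: "in_degree 0 = 0"
proof -
  have "x0 \<in> shell 0" using shell_0 by simp
  then show ?thesis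
    using sphere_value_eq[OF kappa_minus_sym, of x0 0]
    by (simp add: kappa_minus_def in_shell_iff) (simp add: graph_sphere_def)
qed

text \<open>
  Any vertex of the next sphere has a neighbour in this one, so the edge weight between the two
  spheres is not zero.
\<close>

lemma ball_boundary_pos: "ball_boundary V b m x0 r > 0"
proof -
  obtain y where y: "y \<in> shell (Suc r)" using shell_nonempty by blast
  then obtain x where x: "x \<in> shell r" "b y x > 0" by (rule obtain_inner_neighbour)
  then have xy: "b x y > 0" using y b_sym[of x y] by (simp add: in_shell_iff)
  have nonneg: "b x' y' \<ge> 0" if "x' \<in> shell r" "y' \<in> shell (Suc r)" for x' y'
    using that by (intro b_nonneg) (auto simp: in_shell_iff)
  have "(\<Sum>y\<in>shell (Suc r). b x y) > 0"
    using finite_shell y xy nonneg x(1) by (intro sum_pos2[of _ y]) auto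
  then have "(\<Sum>x\<in>shell r. \<Sum>y\<in>shell (Suc r). b x y) > 0"
    by (rule sum_pos2[OF finite_shell x(1)]) (simp add: sum_nonneg nonneg)
  then show ?thesis by (simp add: ball_boundary_eq out_degree_times_shell_mass)
qed

lemma ball_volume_eq:
  "ball_volume V b c m x0 r = (\<Sum>i\<le>r. (radial_potential i + 1) * shell_mass i)"
proof -
  have "ball_volume V b c m x0 r = (\<Sum>i\<in>{0..r}. \<Sum>x\<in>shell i. (potential c m x + 1) * m x)"
    unfolding ball_volume_def graph_ball_def shell_def[symmetric]
    by (rule sum.UNION_disjoint) (auto simp: finite_shell in_shell_iff)
  also have "\<dots> = (\<Sum>i\<in>{0..r}. \<Sum>x\<in>shell i. (radial_potential i + 1) * m x)"
    by (intro sum.cong refl) (simp add: sphere_value_eq[OF potential_sym])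
  finally show ?thesis
    by (simp add: shell_mass_def sum_distrib_left atMost_atLeast0)
qed

text \<open>
  Neighbours of a vertex lie in its own sphere, where a radial function does not change, or in one
  of the two adjacent spheres. At the root \<open>r - 1\<close> truncates to 0, which is harmless because
  that difference is then 0.
\<close>

lemma laplacian_radial:
  assumes x: "x \<in> shell r"
  shows "laplacian V b c m (\<lambda>y. f (depth y)) x =
    out_degree r * (f r - f (Suc r)) + in_degree r * (f r - f (r - 1)) + radial_potential r * f r"
proof -
  let ?N = "neighbours V b x"
  let ?outer = "graph_sphere V b x0 (int r + 1)" and ?inner = "graph_sphere V b x0 (int r - 1)"
  have xV: "x \<in> V" "depth x = r" using x by (auto simp: in_shell_iff)
  have fin: "finite ?outer" "finite ?inner"
  proof -
    show "finite ?outer" using finite_shell[of "Suc r"] by (simp add: shell_def add.commute)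
    show "finite ?inner"
      using finite_shell[of "r - 1"] by (cases r) (auto simp: shell_def graph_sphere_def)
  qed
  have disj: "?outer \<inter> ?inner = {}" by (auto simp: graph_sphere_def)
  have near: "depth y = r \<or> y \<in> ?outer \<union> ?inner" if "y \<in> ?N" for y
  proof -
    have y: "y \<in> V" "b x y > 0" using that by (auto simp: neighbours_def)
    then have "b y x > 0" using b_sym xV by simp
    then have "depth x \<le> Suc (depth y)" "depth y \<le> Suc (depth x)"
      using y xV depth_le_Suc_neighbour by auto
    then show ?thesis using y(1) xV(2) by (auto simp: graph_sphere_def)
  qed
  have "(\<Sum>y\<in>?N. b x y * (f r - f (depth y))) =
      (\<Sum>y\<in>?N \<inter> (?outer \<union> ?inner). b x y * (f r - f (depth y)))"
    using near locally_finite[OF xV(1)] by (intro sum.mono_neutral_right) auto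
  also have "\<dots> = (\<Sum>y\<in>?outer \<union> ?inner. b x y * (f r - f (depth y)))"
    using fin b_nonneg[OF xV(1)]
    by (intro sum.mono_neutral_left) (force simp: neighbours_def graph_sphere_def)+
  also have "\<dots> = (\<Sum>y\<in>?outer. b x y * (f r - f (depth y))) + (\<Sum>y\<in>?inner. b x y * (f r - f (depth y)))"
    using fin disj by (intro sum.union_disjoint) auto
  also have "(\<Sum>y\<in>?outer. b x y * (f r - f (depth y))) = (\<Sum>y\<in>?outer. b x y) * (f r - f (Suc r))"
    unfolding sum_distrib_right
  proof (intro sum.cong refl)
    fix y assume "y \<in> ?outer"
    then have "depth y = Suc r" by (auto simp: graph_sphere_def)
    then show "b x y * (f r - f (depth y)) = b x y * (f r - f (Suc r))" by simp
  qed
  also have "(\<Sum>y\<in>?inner. b x y * (f r - f (depth y))) = (\<Sum>y\<in>?inner. b x y) * (f r - f (r - 1))"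
    unfolding sum_distrib_right
  proof (intro sum.cong refl)
    fix y assume "y \<in> ?inner"
    then have "depth y = r - 1" by (auto simp: graph_sphere_def)
    then show "b x y * (f r - f (depth y)) = b x y * (f r - f (r - 1))" by simp
  qed
  finally have sum_eq: "(\<Sum>y\<in>?N. b x y * (f r - f (depth y))) =
      (\<Sum>y\<in>?outer. b x y) * (f r - f (Suc r)) + (\<Sum>y\<in>?inner. b x y) * (f r - f (r - 1))" .
  show ?thesis
    unfolding sphere_value_eq[OF kappa_plus_sym x] sphere_value_eq[OF kappa_minus_sym x]
      sphere_value_eq[OF potential_sym x] kappa_plus_def kappa_minus_def potential_def laplacian_def
      xV(2) sum_eq
    by (simp only: distrib_left mult.assoc)
qed

section \<open>The radial solution as a barrier\<close>

definition shell_weight :: "real \<Rightarrow> nat \<Rightarrow> real" where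
  "shell_weight \<alpha> r = (radial_potential r + \<alpha>) * shell_mass r"

lemma shell_weight_nonneg: "\<alpha> \<ge> 0 \<Longrightarrow> shell_weight \<alpha> r \<ge> 0"
  using radial_potential_nonneg[of r] shell_mass_pos[of r] by (simp add: shell_weight_def)

lemma ball_volume_eq_shell_weights: "ball_volume V b c m x0 r = (\<Sum>i\<le>r. shell_weight 1 i)"
  by (simp add: ball_volume_eq shell_weight_def)

abbreviation radial_eigen :: "real \<Rightarrow> nat \<Rightarrow> real" where
  "radial_eigen \<alpha> \<equiv> radial_solution (shell_weight \<alpha>) (ball_boundary V b m x0)"

lemma radial_flux:
  "ball_boundary V b m x0 r * (radial_eigen \<alpha> (Suc r) - radial_eigen \<alpha> r) =
    (\<Sum>i\<le>r. shell_weight \<alpha> i * radial_eigen \<alpha> i)"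
  using ball_boundary_pos[of r] by simp

text \<open>
  Multiplied by \<open>m(S\<^sub>r)\<close>, the outer part of the Laplacian is minus the flux through \<open>\<partial>B(r)\<close> and the
  inner part is the flux through \<open>\<partial>B(r - 1)\<close>; by the flux identity they differ by exactly
  \<open>(q(r) + \<alpha>) m(S\<^sub>r) w(r)\<close>.
\<close>

lemma radial_solution_solves:
  assumes "x \<in> V"
  shows "laplacian V b c m (\<lambda>y. radial_eigen \<alpha> (depth y)) x + \<alpha> * radial_eigen \<alpha> (depth x) = 0"
proof -
  define r where "r = depth x"
  have x: "x \<in> shell r" using assms by (simp add: in_shell_iff r_def)
  let ?w = "radial_eigen \<alpha>" and ?Q = "\<lambda>r. \<Sum>i\<le>r. shell_weight \<alpha> i * radial_eigen \<alpha> i"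
  have inner: "shell_mass r * (in_degree r * (?w r - ?w (r - 1))) = ?Q r - shell_weight \<alpha> r * ?w r"
  proof (cases r)
    case 0
    then show ?thesis by (simp add: in_degree_0)
  next
    case (Suc k)
    have "shell_mass r * (in_degree r * (?w r - ?w (r - 1))) =
        (in_degree (Suc k) * shell_mass (Suc k)) * (?w (Suc k) - ?w k)"
      by (simp only: Suc diff_Suc_1 mult_ac)
    also have "\<dots> = ?Q k"
      unfolding edge_weight_balance ball_boundary_eq[symmetric] by (rule radial_flux)
    finally show ?thesis by (simp add: Suc)
  qed
  have outer: "shell_mass r * (out_degree r * (?w r - ?w (Suc r))) = - ?Q r"
    unfolding radial_flux[symmetric] ball_boundary_eq by (simp only: algebra_simps)
  have "shell_mass r * (laplacian V b c m (\<lambda>y. ?w (depth y)) x + \<alpha> * ?w r) =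
      shell_mass r * (out_degree r * (?w r - ?w (Suc r))) +
      shell_mass r * (in_degree r * (?w r - ?w (r - 1))) + shell_weight \<alpha> r * ?w r"
    unfolding laplacian_radial[OF x] shell_weight_def by (simp only: algebra_simps)
  also have "\<dots> = 0" unfolding inner outer by simp
  finally show ?thesis using shell_mass_pos[of r] by (simp add: r_def)
qed

text \<open>
  Divergence does not depend on \<open>\<alpha> > 0\<close>, because \<open>q + 1 \<le> max 1 (1 / \<alpha>) (q + \<alpha>)\<close>.
\<close>

lemma not_summable_shell_weights:
  assumes "\<alpha> > 0" "\<not> summable (\<lambda>r. ball_volume V b c m x0 r / ball_boundary V b m x0 r)"
  shows "\<not> summable (\<lambda>r. (\<Sum>i\<le>r. shell_weight \<alpha> i) / ball_boundary V b m x0 r)"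
proof
  assume *: "summable (\<lambda>r. (\<Sum>i\<le>r. shell_weight \<alpha> i) / ball_boundary V b m x0 r)"
  define k where "k = max 1 (1 / \<alpha>)"
  have le: "shell_weight 1 i \<le> k * shell_weight \<alpha> i" for i
  proof -
    have "radial_potential i * 1 \<le> radial_potential i * k"
      using radial_potential_nonneg[of i] by (rule mult_left_mono[rotated]) (simp add: k_def)
    moreover have "1 \<le> k * \<alpha>"
      using assms(1) by (simp add: k_def flip: pos_divide_le_eq)
    ultimately have "radial_potential i + 1 \<le> k * (radial_potential i + \<alpha>)"
      by (simp add: algebra_simps)
    then show ?thesis
      unfolding shell_weight_def mult.assoc[symmetric]
      using shell_mass_pos[of i] by (intro mult_right_mono) auto
  qed
  have "summable (\<lambda>r. ball_volume V b c m x0 r / ball_boundary V b m x0 r)"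
  proof (rule summable_comparison_test'[OF summable_mult[OF *, of k], of 0])
    fix r
    have "ball_volume V b c m x0 r \<le> k * (\<Sum>i\<le>r. shell_weight \<alpha> i)"
      unfolding ball_volume_eq_shell_weights sum_distrib_left by (intro sum_mono le)
    moreover have "ball_volume V b c m x0 r \<ge> 0"
      unfolding ball_volume_eq_shell_weights by (intro sum_nonneg shell_weight_nonneg) simp
    ultimately show "norm (ball_volume V b c m x0 r / ball_boundary V b m x0 r)
        \<le> k * ((\<Sum>i\<le>r. shell_weight \<alpha> i) / ball_boundary V b m x0 r)"
      using ball_boundary_pos[of r] by (simp add: divide_right_mono)
  qed
  with assms(2) show False by simp
qed

lemma finite_sublevel_radial:
  assumes "finite {r. f r \<le> K}"
  shows "finite {x \<in> V. f (depth x) \<le> K}"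
proof (rule finite_subset)
  show "{x \<in> V. f (depth x) \<le> K} \<subseteq> (\<Union>r\<in>{r. f r \<le> K}. shell r)"
    by (auto simp: in_shell_iff)
  show "finite (\<Union>r\<in>{r. f r \<le> K}. shell r)" using assms finite_shell by auto
qed

lemma complete_iff_not_summable:
  "stochastically_complete_at_infinity V b c m \<longleftrightarrow>
    \<not> summable (\<lambda>r. ball_volume V b c m x0 r / ball_boundary V b m x0 r)"
proof
  assume complete: "stochastically_complete_at_infinity V b c m"
  show "\<not> summable (\<lambda>r. ball_volume V b c m x0 r / ball_boundary V b m x0 r)"
  proof
    assume "summable (\<lambda>r. ball_volume V b c m x0 r / ball_boundary V b m x0 r)"
    then obtain K where K: "\<And>r. radial_eigen 1 r \<le> K"
      using bounded_radial_solution[of "shell_weight 1" "ball_boundary V b m x0"]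
        shell_weight_nonneg[of 1] ball_boundary_pos
      by (auto simp: ball_volume_eq_shell_weights)
    have ge1: "radial_eigen 1 r \<ge> 1" for r
      by (intro radial_solution_ge_1 shell_weight_nonneg ball_boundary_pos) simp
    have "radial_eigen 1 r > 0" "\<bar>radial_eigen 1 r\<bar> \<le> K" for r using K[of r] ge1[of r] by auto
    then have "has_bounded_positive_solution V b c m 1"
      unfolding has_bounded_positive_solution_def bounded_iff
      by (intro exI[of _ "\<lambda>x. radial_eigen 1 (depth x)"])
        (use radial_solution_solves[of _ 1] in auto)
    then show False
      using complete zero_less_one unfolding stochastically_complete_at_infinity_def
        stochastically_incomplete_at_infinity_def by blast
  qed
next
  assume diverges: "\<not> summable (\<lambda>r. ball_volume V b c m x0 r / ball_boundary V b m x0 r)"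
  have w: "radial_eigen \<alpha> (depth x) > 0" "finite {x \<in> V. radial_eigen \<alpha> (depth x) \<le> K}"
    if "\<alpha> > 0" for \<alpha> x K
  proof -
    have nonneg: "shell_weight \<alpha> r \<ge> 0" for r using that by (simp add: shell_weight_nonneg)
    have "radial_eigen \<alpha> (depth x) \<ge> 1"
      by (intro radial_solution_ge_1 nonneg ball_boundary_pos)
    then show "radial_eigen \<alpha> (depth x) > 0" by simp
    have "finite {r. radial_eigen \<alpha> r \<le> K}"
      by (rule finite_radial_solution_sublevel[OF nonneg ball_boundary_pos
            not_summable_shell_weights[OF that diverges]])
    then show "finite {x \<in> V. radial_eigen \<alpha> (depth x) \<le> K}"
      by (rule finite_sublevel_radial[of "radial_eigen \<alpha>"])
  qed
  have super: "laplacian V b c m (\<lambda>y. radial_eigen \<alpha> (depth y)) x + \<alpha> * radial_eigen \<alpha> (depth x) \<ge> 0"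
    if "x \<in> V" for \<alpha> x
    using radial_solution_solves[OF that, of \<alpha>] by simp
  have no_sub: "\<not> has_bounded_subsolution V b c m \<alpha>" if "\<alpha> > 0" for \<alpha>
    by (rule no_bounded_subsolution[of \<alpha> "\<lambda>x. radial_eigen \<alpha> (depth x)",
          OF that w(1)[OF that] w(2)[OF that] super])
  have no_sol: "\<not> has_bounded_positive_solution V b c m \<alpha>" if "\<alpha> > 0" for \<alpha>
  proof
    assume "has_bounded_positive_solution V b c m \<alpha>"
    then obtain v where v: "\<And>x. x \<in> V \<Longrightarrow> v x > 0" "bounded (v ` V)"
      "\<And>x. x \<in> V \<Longrightarrow> laplacian V b c m v x + \<alpha> * v x = 0"
      unfolding has_bounded_positive_solution_def by blast
    have "\<forall>x\<in>V. v x \<ge> 0" "\<exists>x\<in>V. v x \<noteq> 0" "\<forall>x\<in>V. laplacian V b c m v x + \<alpha> * v x \<le> 0"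
      using v(1) v(3) root_in_V by (force simp: less_imp_le)+
    with v(2) have "has_bounded_subsolution V b c m \<alpha>"
      unfolding has_bounded_subsolution_def by blast
    with no_sub[OF that] show False by contradiction
  qed
  have no_heat: "\<not> has_nontrivial_bounded_heat_solution V b c m"
    by (rule no_nontrivial_bounded_heat_solution[of "\<lambda>x. radial_eigen 1 (depth x)" 1,
          OF w(1)[OF zero_less_one] w(2)[OF zero_less_one] super zero_less_one])
  show "stochastically_complete_at_infinity V b c m"
    unfolding stochastically_complete_at_infinity_def stochastically_incomplete_at_infinity_def
    using no_sub no_sol no_heat by blast
qed

end

theorem theorem5:
  fixes V :: "'a set"
    and b :: "'a \<Rightarrow> 'a \<Rightarrow> real"
    and c m :: "'a \<Rightarrow> real"
    and x0 :: 'a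
  assumes "weakly_spherically_symmetric_graph V b c m x0"
  shows "stochastically_complete_at_infinity V b c m \<longleftrightarrow>
    (\<Sum>r. ennreal (ball_volume V b c m x0 r / ball_boundary V b m x0 r)) = \<infinity>"
proof -
  interpret weakly_spherically_symmetric_graph V b c m x0 by fact
  let ?a = "\<lambda>r. ball_volume V b c m x0 r / ball_boundary V b m x0 r"
  have nonneg: "?a r \<ge> 0" for r
    unfolding ball_volume_eq_shell_weights
    using shell_weight_nonneg[of 1] ball_boundary_pos[of r]
    by (intro divide_nonneg_pos sum_nonneg) auto
  have "summable ?a \<longleftrightarrow> (\<Sum>r. ennreal (?a r)) \<noteq> top"
    using summable_suminf_not_top[of ?a, OF nonneg] ennreal_suminf_neq_top[of ?a, OF _ nonneg]
    by blast
  then show ?thesis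
    unfolding complete_iff_not_summable infinity_ennreal_def by blast
qed

end
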